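(* For every integer $n\ge 2$, the set of polynomials $GBI_n=\{g_1(n),g_2(n),g_3(n),g_4(n)\}$ is a strong Gröbner basis (over the base ring $\mathbb{Z}$) of the ideal $I_n\subset\mathbb{Z}[x,y]$ with respect to the lexicographic term order.
   Context: In $\mathbb{Z}[x,y]$ put $b_1(n)=1+x+\cdots+x^{n-1}$, $b_2(n)=1+y+\cdots+y^{n-1}$, $b_3(n)=x^{n-1}+x^{n-2}y+\cdots+y^{n-1}$, and let $I_n=\langle b_1(n),b_2(n),b_3(n)\rangle$ be the ideal they generate. For $m\ge 1$ let $T(m)=\sum_{i,j\ge 0,\ i+j\le m-1}x^iy^j$. Define $g_1(n)=b_1(n)$, $g_2(n)=b_2(n)$, $g_3(n)=n\,T(n-1)$, $g_4(n)=b_3(n)-b_1(n)-b_2(n)$. The lexicographic order is the one with $x>y$. A term is $cx^ay^b$ with $c\in\mathbb{Z}$ nonzero; the leading term $LT(f)$ of a nonzero polynomial $f$ is its term with the largest monomial, including the coefficient. A finite set $G\subset I$ is a strong Gröbner basis of an ideal $I\subset\mathbb{Z}[x,y]$ if for each $f\in I\setminus\{0\}$ there exists $g\in G$ such that $LT(g)$ divides $LT(f)$, meaning that $LT(f)=t\,LT(g)$ for some term $t$ (with integer coefficient). *)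

theory Defs
  imports "HOL-Computational_Algebra.Polynomial"
begin

text \<open>
  The ring \<open>\<int>[x,y]\<close> is \<^typ>\<open>int poly poly\<close>, with \<open>x\<close> the outer and \<open>y\<close> the inner variable;
  the coefficient of \<open>x\<^sup>a y\<^sup>b\<close> in \<open>f\<close> is \<open>coeff (coeff f a) b\<close>.
\<close>

type_synonym zpoly2 = "int poly poly"

definition varx :: zpoly2 where
  "varx = [:0, 1:]"

definition vary :: zpoly2 where
  "vary = [:[:0, 1:]:]"

definition mk_term :: "int \<Rightarrow> nat \<times> nat \<Rightarrow> zpoly2" where
  "mk_term c m = of_int c * varx ^ fst m * vary ^ snd m"

definition is_term :: "zpoly2 \<Rightarrow> bool" where
  "is_term t \<longleftrightarrow> (\<exists>c m. c \<noteq> 0 \<and> t = mk_term c m)"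

definition coeff2 :: "zpoly2 \<Rightarrow> nat \<times> nat \<Rightarrow> int" where
  "coeff2 f m = coeff (coeff f (fst m)) (snd m)"

definition supp :: "zpoly2 \<Rightarrow> (nat \<times> nat) set" where
  "supp f = {m. coeff2 f m \<noteq> 0}"

text \<open>
  Monomials are represented by their exponent pairs and orders on them by the strict order
  relation. The exponent of \<open>x\<close> is compared first, i.e. \<open>x > y\<close>.
\<close>

definition lex_order :: "(nat \<times> nat) rel" where
  "lex_order = less_than <*lex*> less_than"

definition lead_mon :: "(nat \<times> nat) rel \<Rightarrow> zpoly2 \<Rightarrow> nat \<times> nat" where
  "lead_mon r f = (THE m. m \<in> supp f \<and> (\<forall>k\<in>supp f. k \<noteq> m \<longrightarrow> (k, m) \<in> r))"

text \<open>
  The leading term is only meaningful for nonzero polynomials; here it is \<open>0\<close> for the zero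
  polynomial, which therefore divides no leading term of a nonzero polynomial.
\<close>

definition lead_term :: "(nat \<times> nat) rel \<Rightarrow> zpoly2 \<Rightarrow> zpoly2" where
  "lead_term r f = mk_term (coeff2 f (lead_mon r f)) (lead_mon r f)"

definition term_dvd :: "zpoly2 \<Rightarrow> zpoly2 \<Rightarrow> bool" where
  "term_dvd u v \<longleftrightarrow> (\<exists>t. is_term t \<and> v = t * u)"

definition strong_groebner_basis ::
    "(nat \<times> nat) rel \<Rightarrow> zpoly2 set \<Rightarrow> zpoly2 set \<Rightarrow> bool" where
  "strong_groebner_basis r G I \<longleftrightarrow>
     finite G \<and> G \<subseteq> I \<and>
     (\<forall>f\<in>I - {0}. \<exists>g\<in>G. term_dvd (lead_term r g) (lead_term r f))"

text \<open>
  A commutative ring is a module over itself; its submodules are the ideals, and the span of a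
  set is the ideal generated by it.
\<close>

global_interpretation ring_ideal: module "(*) :: 'a::comm_ring_1 \<Rightarrow> 'a \<Rightarrow> 'a"
  by unfold_locales (simp_all add: algebra_simps)

definition b1 :: "nat \<Rightarrow> zpoly2" where
  "b1 n = (\<Sum>k<n. varx ^ k)"

definition b2 :: "nat \<Rightarrow> zpoly2" where
  "b2 n = (\<Sum>k<n. vary ^ k)"

definition b3 :: "nat \<Rightarrow> zpoly2" where
  "b3 n = (\<Sum>k<n. varx ^ (n - 1 - k) * vary ^ k)"

definition ideal_I :: "nat \<Rightarrow> zpoly2 set" where
  "ideal_I n = ring_ideal.span {b1 n, b2 n, b3 n}"

text \<open>For \<open>m \<ge> 1\<close> the condition \<open>i + j < m\<close> is \<open>i + j \<le> m - 1\<close>.\<close>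

definition T :: "nat \<Rightarrow> zpoly2" where
  "T m = (\<Sum>(i, j) | i + j < m. varx ^ i * vary ^ j)"

lemma finite_T_index: "finite {(i, j). i + j < (m::nat)}"
  by (rule finite_subset[of _ "{..<m} \<times> {..<m}"]) auto

definition g1 :: "nat \<Rightarrow> zpoly2" where
  "g1 n = b1 n"

definition g2 :: "nat \<Rightarrow> zpoly2" where
  "g2 n = b2 n"

definition g3 :: "nat \<Rightarrow> zpoly2" where
  "g3 n = of_nat n * T (n - 1)"

definition g4 :: "nat \<Rightarrow> zpoly2" where
  "g4 n = b3 n - b1 n - b2 n"

definition GBI :: "nat \<Rightarrow> zpoly2 set" where
  "GBI n = {g1 n, g2 n, g3 n, g4 n}"

lemma varx_power: "varx ^ a = monom 1 a"
  by (simp add: varx_def monom_altdef)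

lemma vary_power: "vary ^ b = [:monom 1 b:]"
proof -
  have "vary ^ b = [:[:0, 1:] ^ b:]"
    by (simp add: vary_def poly_const_pow)
  then show ?thesis
    by (simp add: monom_altdef)
qed

lemma coeff2_mk_term: "coeff2 (mk_term c m) k = (if k = m then c else 0)"
proof -
  have "mk_term c m = monom (monom c (snd m)) (fst m)"
    by (simp add: mk_term_def varx_power vary_power of_int_poly smult_monom)
  then show ?thesis
    by (cases m; cases k) (simp add: coeff2_def)
qed

lemma lead_mon_lex:
  assumes "f \<noteq> 0"
  shows "lead_mon lex_order f = (degree f, degree (lead_coeff f))"
  unfolding lead_mon_def
proof (rule the_equality)
  show *: "(degree f, degree (lead_coeff f)) \<in> supp f \<and>
      (\<forall>k\<in>supp f. k \<noteq> (degree f, degree (lead_coeff f)) \<longrightarrow>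
        (k, (degree f, degree (lead_coeff f))) \<in> lex_order)"
  proof (intro conjI ballI impI)
    show "(degree f, degree (lead_coeff f)) \<in> supp f"
      using assms by (simp add: supp_def coeff2_def)
  next
    fix k assume k: "k \<in> supp f" "k \<noteq> (degree f, degree (lead_coeff f))"
    obtain a b where [simp]: "k = (a, b)" by fastforce
    have nz: "coeff (coeff f a) b \<noteq> 0"
      using k by (simp add: supp_def coeff2_def)
    then have "a \<le> degree f" "b \<le> degree (coeff f a)"
      by (auto intro: le_degree)
    then show "(k, (degree f, degree (lead_coeff f))) \<in> lex_order"
      using k by (auto simp: lex_order_def le_less)
  qed
  show "m = (degree f, degree (lead_coeff f))"
    if "m \<in> supp f \<and> (\<forall>k\<in>supp f. k \<noteq> m \<longrightarrow> (k, m) \<in> lex_order)" for m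
  proof (rule ccontr)
    let ?d = "(degree f, degree (lead_coeff f))"
    assume "m \<noteq> ?d"
    then have "(?d, m) \<in> lex_order" "(m, ?d) \<in> lex_order"
      using that * by metis+
    then show False
      by (cases m) (auto simp: lex_order_def)
  qed
qed

end

theory Submission imports Defs begin

text \<open>
  Write \<open>T = T (n - 1)\<close>. The telescoping identities
  \<open>(x - y) T = b\<^sub>1 - b\<^sub>2\<close> and \<open>(y - 1) T = b\<^sub>3 - b\<^sub>1\<close>
  (lemmas \<open>b1_eq\<close> and \<open>b3_eq\<close>) show that \<open>I\<^sub>n\<close> is generated by \<open>b\<^sub>2\<close>, \<open>(x - y) T\<close> and
  \<open>(y - 1) T\<close>. Since \<open>b\<^sub>2\<close> is \<open>n\<close> modulo \<open>y - 1\<close>, also \<open>n T\<close> lies in \<open>I\<^sub>n\<close>. The leading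
  terms of the four polynomials are \<open>x\<^bsup>n-1\<^esup>\<close>, \<open>y\<^bsup>n-1\<^esup>\<close>, \<open>n x\<^bsup>n-2\<^esup>\<close> and, for \<open>n \<ge> 3\<close>,
  \<open>x\<^bsup>n-2\<^esup> y\<close>.

  Let \<open>f \<noteq> 0\<close> be in \<open>I\<^sub>n\<close>, viewed as a polynomial in \<open>x\<close> over \<open>\<int>[y]\<close>; if its degree is at
  least \<open>n - 1\<close>, there is nothing to show. Otherwise two applications of the same fact about
  division by a monic polynomial (lemma \<open>dvd_coeff_of_monic_combination\<close>) suffice:
  \<^item> \<open>f\<close> is in the ideal generated by \<open>b\<^sub>2\<close> and \<open>T\<close>, and \<open>T\<close> is monic in \<open>x\<close> of degree \<open>n - 2\<close>.
    So if \<open>f\<close> has degree less than \<open>n - 2\<close>, all its coefficients are multiples of \<open>b\<^sub>2\<close>, and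
    the leading term of \<open>f\<close> is a multiple of \<open>y\<^bsup>n-1\<^esup>\<close>.
  \<^item> \<open>f(x,1)\<close> is in the ideal generated by \<open>n\<close> and the monic polynomial \<open>(x - 1) T(x,1)\<close> of
    degree \<open>n - 1\<close>, so \<open>n\<close> divides \<open>f(x,1)\<close>. If \<open>f\<close> has degree \<open>n - 2\<close> and its leading term
    does not contain \<open>y\<close>, then the leading coefficient of \<open>f\<close> over \<open>\<int>[y]\<close> is an integer, and
    therefore a multiple of \<open>n\<close>. If it does contain \<open>y\<close>, it is a multiple of \<open>x\<^bsup>n-2\<^esup> y\<close>.
\<close>

section \<open>Division by a monic polynomial\<close>

lemma dvd_coeff_of_monic_combination:
  fixes f p A B :: "'a::idom poly"
  assumes f: "f = [:d:] * A + B * p"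
    and monic: "lead_coeff p = 1"
    and deg: "degree f < degree p"
  shows "d dvd coeff f i"
proof -
  have "p \<noteq> 0"
    using monic by auto
  obtain q r where qr: "pseudo_divmod A p = (q, r)"
    by fastforce
  have A: "A = p * q + r" and r: "r = 0 \<or> degree r < degree p"
    using pseudo_divmod[OF \<open>p \<noteq> 0\<close> qr] monic by simp_all
  have eq: "f - [:d:] * r = p * (B + [:d:] * q)"
    by (simp add: f A algebra_simps)
  have "degree ([:d:] * r) < degree p"
    using r deg degree_smult_le[of d r] by auto
  with deg have small: "degree (f - [:d:] * r) < degree p"
    by (rule degree_diff_less)
  have "B + [:d:] * q = 0"
  proof (rule ccontr)
    assume "B + [:d:] * q \<noteq> 0"
    with \<open>p \<noteq> 0\<close> have "degree p \<le> degree (p * (B + [:d:] * q))"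
      by (simp add: degree_mult_eq)
    with small eq show False
      by simp
  qed
  with eq have "f = smult d r"
    by simp
  then show ?thesis
    by simp
qed

section \<open>Generators of the ideal\<close>

lemma T_altdef: "T m = (\<Sum>i<m. varx ^ i * (\<Sum>j<m - i. vary ^ j))"
proof -
  have "{(i, j). i + j < m} = Sigma {..<m} (\<lambda>i. {..<m - i})"
    by auto
  then show ?thesis
    by (simp add: T_def sum.Sigma sum_distrib_left)
qed

lemma b3_altdef: "b3 (Suc m) = (\<Sum>i<Suc m. varx ^ i * vary ^ (m - i))"
  unfolding b3_def by (subst sum.nat_diff_reindex[symmetric]) (intro sum.cong, auto)

text \<open>The terms of total degree \<open>m\<close> are those of \<open>b3 (Suc m)\<close>.\<close>

lemma T_Suc: "T (Suc m) = T m + b3 (Suc m)"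
proof -
  have "T (Suc m) = (\<Sum>i<m. varx ^ i * (\<Sum>j<Suc m - i. vary ^ j)) + varx ^ m"
    by (simp add: T_altdef)
  also have "(\<Sum>i<m. varx ^ i * (\<Sum>j<Suc m - i. vary ^ j)) =
      (\<Sum>i<m. varx ^ i * (\<Sum>j<m - i. vary ^ j) + varx ^ i * vary ^ (m - i))"
    by (intro sum.cong) (auto simp: Suc_diff_le algebra_simps)
  also have "\<dots> + varx ^ m = T m + (\<Sum>i<Suc m. varx ^ i * vary ^ (m - i))"
    by (simp add: T_altdef sum.distrib)
  also have "(\<Sum>i<Suc m. varx ^ i * vary ^ (m - i)) = b3 (Suc m)"
    by (simp only: b3_altdef)
  finally show ?thesis .
qed

lemma diff_mult_b3: "(varx - vary) * b3 (Suc m) = varx ^ Suc m - vary ^ Suc m"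
  by (simp only: b3_altdef diff_power_eq_sum)

lemma b1_eq: "b1 (Suc m) = b2 (Suc m) + (varx - vary) * T m"
proof (induction m)
  case 0
  then show ?case by (simp add: b1_def b2_def T_altdef)
next
  case (Suc m)
  have "(varx - vary) * T (Suc m) = (varx - vary) * T m + (varx ^ Suc m - vary ^ Suc m)"
    by (simp only: T_Suc distrib_left diff_mult_b3)
  moreover have "b1 (Suc (Suc m)) = b1 (Suc m) + varx ^ Suc m"
    "b2 (Suc (Suc m)) = b2 (Suc m) + vary ^ Suc m"
    by (simp_all add: b1_def b2_def)
  ultimately show ?case
    using Suc.IH by (simp only:)
qed

lemma b3_eq: "b3 (Suc m) = b1 (Suc m) + (vary - 1) * T m"
proof -
  have "(vary - 1) * T m = (\<Sum>i<m. varx ^ i * (vary ^ (m - i) - 1))"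
    unfolding T_altdef sum_distrib_left[of "vary - 1"]
    by (intro sum.cong) (simp_all only: power_diff_1_eq mult.left_commute sum_distrib_left)
  also have "\<dots> = (\<Sum>i<Suc m. varx ^ i * vary ^ (m - i)) - b1 (Suc m)"
    by (simp add: b1_def algebra_simps sum_subtractf)
  also have "(\<Sum>i<Suc m. varx ^ i * vary ^ (m - i)) = b3 (Suc m)"
    by (simp only: b3_altdef)
  finally show ?thesis
    by simp
qed

lemma g4_eq: "g4 (Suc m) = (vary - 1) * T m - b2 (Suc m)"
  unfolding g4_def b3_eq by algebra

lemma generators_in_ideal:
  "b1 n \<in> ideal_I n" "b2 n \<in> ideal_I n" "b3 n \<in> ideal_I n"
  unfolding ideal_I_def by (rule ring_ideal.span_base, simp)+

lemma ideal_I_cases: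
  assumes "f \<in> ideal_I (Suc m)"
  obtains A B C where
    "f = A * b2 (Suc m) + B * (varx - vary) * T m + C * (vary - 1) * T m"
proof -
  from assms obtain a b c where
    "f - a * b1 (Suc m) - b * b2 (Suc m) - c * b3 (Suc m) = 0"
    unfolding ideal_I_def
    by (auto simp: ring_ideal.span_insert)
  then have "f = (a + b + c) * b2 (Suc m) + (a + c) * (varx - vary) * T m + c * (vary - 1) * T m"
    unfolding b3_eq b1_eq by algebra
  then show ?thesis
    by (rule that)
qed

text \<open>\<open>n T = b\<^sub>2 T - s (y - 1) T\<close>, where \<open>s\<close> is the quotient of \<open>b\<^sub>2 - n\<close> by \<open>y - 1\<close>.\<close>

lemma g3_in_ideal: "g3 (Suc m) \<in> ideal_I (Suc m)"
proof -
  have "b2 (Suc m) - of_nat (Suc m) = (\<Sum>k<Suc m. vary ^ k - 1)"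
    by (simp add: b2_def sum_subtractf)
  also have "vary - 1 dvd \<dots>"
    by (intro dvd_sum) (metis power_diff_1_eq dvd_triv_left)
  finally obtain s where s: "b2 (Suc m) - of_nat (Suc m) = (vary - 1) * s"
    by (elim dvdE)
  have "g3 (Suc m) = (b2 (Suc m) - (vary - 1) * s) * T m"
    unfolding s[symmetric] by (simp add: g3_def)
  also have "\<dots> = T m * b2 (Suc m) - s * (b3 (Suc m) - b1 (Suc m))"
    unfolding b3_eq by algebra
  finally have "g3 (Suc m) = T m * b2 (Suc m) - s * (b3 (Suc m) - b1 (Suc m))" .
  moreover have "\<dots> \<in> ideal_I (Suc m)"
    using generators_in_ideal[of "Suc m"] unfolding ideal_I_def
    by (intro ring_ideal.span_diff ring_ideal.span_scale)
  ultimately show ?thesis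
    by simp
qed

lemma GBI_subset_ideal: "GBI (Suc m) \<subseteq> ideal_I (Suc m)"
proof -
  have "g4 (Suc m) \<in> ideal_I (Suc m)"
    using generators_in_ideal[of "Suc m"] unfolding g4_def ideal_I_def
    by (intro ring_ideal.span_diff)
  with g3_in_ideal generators_in_ideal show ?thesis
    by (simp add: GBI_def g1_def g2_def)
qed

section \<open>Leading terms\<close>

lemma b2_const: "b2 n = [:\<Sum>k<n. monom 1 k:]"
  by (induction n) (simp_all add: b2_def vary_power)

lemma coeff_T: "coeff (T m) i = (if i < m then \<Sum>j<m - i. monom 1 j else 0)"
proof -
  have "T m = (\<Sum>i<m. monom (\<Sum>j<m - i. monom 1 j) i)"
    unfolding T_altdef b2_def[symmetric]
    by (simp add: b2_const varx_power smult_monom)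
  then show ?thesis
    by (simp add: coeff_sum)
qed

lemma degree_sum_monom: "degree (\<Sum>k<Suc m. monom (1::'a::comm_ring_1) k) = m"
  and lead_coeff_sum_monom: "coeff (\<Sum>k<Suc m. monom (1::'a::comm_ring_1) k) m = 1"
proof -
  have c: "coeff (\<Sum>k<Suc m. monom (1::'a) k) i = (if i \<le> m then 1 else 0)" for i
    by (simp add: coeff_sum)
  show "coeff (\<Sum>k<Suc m. monom (1::'a) k) m = 1"
    by (simp add: c del: sum.lessThan_Suc)
  show "degree (\<Sum>k<Suc m. monom (1::'a) k) = m"
    by (rule antisym[OF degree_le le_degree]) (auto simp: c simp del: sum.lessThan_Suc)
qed

lemma degree_T: "degree (T (Suc m)) = m"
  and lead_coeff_T: "coeff (T (Suc m)) m = 1"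
proof -
  show "coeff (T (Suc m)) m = 1"
    by (simp add: coeff_T)
  then show "degree (T (Suc m)) = m"
    by (intro antisym[OF degree_le le_degree]) (auto simp: coeff_T)
qed

lemma lead_term_eq:
  assumes "degree g = a" "degree (coeff g a) = b" "coeff (coeff g a) b = c" "c \<noteq> 0"
  shows "lead_term lex_order g = mk_term c (a, b)"
proof -
  have "g \<noteq> 0"
    using assms by auto
  then show ?thesis
    using assms by (simp add: lead_term_def lead_mon_lex coeff2_def)
qed

lemma lead_term_g1: "lead_term lex_order (g1 (Suc m)) = mk_term 1 (m, 0)"
proof (rule lead_term_eq)
  have *: "g1 (Suc m) = (\<Sum>k<Suc m. monom 1 k)"
    by (simp only: g1_def b1_def varx_power)
  show "degree (g1 (Suc m)) = m"
    by (simp only: * degree_sum_monom)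
  show "degree (coeff (g1 (Suc m)) m) = 0" "coeff (coeff (g1 (Suc m)) m) 0 = 1"
    by (simp_all only: * lead_coeff_sum_monom) simp_all
qed simp

lemma lead_term_g2: "lead_term lex_order (g2 (Suc m)) = mk_term 1 (0, m)"
proof (rule lead_term_eq)
  have *: "g2 (Suc m) = [:\<Sum>k<Suc m. monom 1 k:]"
    by (simp only: g2_def b2_const)
  show "degree (g2 (Suc m)) = 0"
    by (simp only: * degree_pCons_0)
  show "degree (coeff (g2 (Suc m)) 0) = m" "coeff (coeff (g2 (Suc m)) 0) m = 1"
    by (simp_all only: * coeff_pCons_0 degree_sum_monom lead_coeff_sum_monom)
qed simp

lemma lead_term_g3:
  "lead_term lex_order (g3 (Suc (Suc m))) = mk_term (int (Suc (Suc m))) (m, 0)"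
proof (rule lead_term_eq)
  have *: "g3 (Suc (Suc m)) = smult (of_nat (Suc (Suc m))) (T (Suc m))"
    by (simp add: g3_def of_nat_poly del: of_nat_Suc)
  show "degree (g3 (Suc (Suc m))) = m"
    by (simp add: * degree_T del: of_nat_Suc)
  show "degree (coeff (g3 (Suc (Suc m))) m) = 0"
    "coeff (coeff (g3 (Suc (Suc m))) m) 0 = int (Suc (Suc m))"
    by (simp_all add: * lead_coeff_T of_nat_poly del: of_nat_Suc)
qed simp

lemma lead_term_g4:
  "lead_term lex_order (g4 (Suc (Suc (Suc m)))) = mk_term 1 (Suc m, 1)"
proof (rule lead_term_eq)
  have c: "coeff (g4 (Suc (Suc (Suc m)))) (Suc i) = [:-1, 1:] * coeff (T (Suc (Suc m))) (Suc i)"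
    for i
  proof -
    have "vary - 1 = [:[:-1, 1:]:]"
      by (simp add: vary_def one_pCons)
    then show ?thesis
      by (simp add: g4_eq b2_const)
  qed
  have l: "coeff (g4 (Suc (Suc (Suc m)))) (Suc m) = [:-1, 1:]"
    by (simp add: c lead_coeff_T)
  have "coeff (g4 (Suc (Suc (Suc m)))) i = 0" if "i > Suc m" for i
    using that by (cases i) (auto simp: c coeff_T)
  with l show "degree (g4 (Suc (Suc (Suc m)))) = Suc m"
    by (intro antisym[OF degree_le le_degree]) auto
  show "degree (coeff (g4 (Suc (Suc (Suc m)))) (Suc m)) = 1"
    "coeff (coeff (g4 (Suc (Suc (Suc m)))) (Suc m)) 1 = 1"
    by (simp_all add: l)
qed simp

lemma mk_term_mult: "mk_term c (i, j) * mk_term d (k, l) = mk_term (c * d) (i + k, j + l)"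
  by (simp only: mk_term_def fst_conv snd_conv of_int_mult power_add mult_ac)

lemma term_dvd_mk_term:
  assumes "c dvd d" "d \<noteq> 0" "i \<le> k" "j \<le> l"
  shows "term_dvd (mk_term c (i, j)) (mk_term d (k, l))"
proof -
  obtain e where e: "d = c * e"
    using assms by auto
  have "mk_term d (k, l) = mk_term e (k - i, l - j) * mk_term c (i, j)"
    using assms by (simp add: mk_term_mult e mult.commute)
  moreover have "is_term (mk_term e (k - i, l - j))"
    using assms e unfolding is_term_def by auto
  ultimately show ?thesis
    unfolding term_dvd_def by blast
qed

section \<open>Elements of the ideal of small degree\<close>

lemma b2_dvd_coeff:
  assumes "f \<in> ideal_I (Suc (Suc m))" "degree f < m"
  shows "(\<Sum>k<Suc (Suc m). monom 1 k) dvd coeff f i"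
proof -
  from assms(1) obtain A B C where
    "f = A * b2 (Suc (Suc m)) + B * (varx - vary) * T (Suc m) + C * (vary - 1) * T (Suc m)"
    by (rule ideal_I_cases)
  then have "f = [:\<Sum>k<Suc (Suc m). monom 1 k:] * A +
      (B * (varx - vary) + C * (vary - 1)) * T (Suc m)"
    by (simp only: b2_const algebra_simps)
  then show ?thesis
    by (rule dvd_coeff_of_monic_combination) (use assms(2) in \<open>simp_all add: degree_T lead_coeff_T\<close>)
qed

text \<open>The substitution of \<open>1\<close> for \<open>y\<close>.\<close>

definition subst_y_1 :: "zpoly2 \<Rightarrow> int poly" where
  "subst_y_1 = map_poly (\<lambda>p. poly p 1)"

lemma coeff_subst_y_1: "coeff (subst_y_1 f) i = poly (coeff f i) 1"
  by (simp add: subst_y_1_def coeff_map_poly)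

lemma subst_y_1_add: "subst_y_1 (f + g) = subst_y_1 f + subst_y_1 g"
  by (rule poly_eqI) (simp add: coeff_subst_y_1)

lemma subst_y_1_mult: "subst_y_1 (f * g) = subst_y_1 f * subst_y_1 g"
  by (rule poly_eqI) (simp add: coeff_subst_y_1 coeff_mult poly_sum)

lemma n_dvd_subst_y_1:
  assumes "f \<in> ideal_I (Suc (Suc m))" "degree f \<le> m"
  shows "int (Suc (Suc m)) dvd poly (coeff f i) 1"
proof -
  from assms(1) obtain A B C where f:
    "f = A * b2 (Suc (Suc m)) + B * (varx - vary) * T (Suc m) + C * (vary - 1) * T (Suc m)"
    by (rule ideal_I_cases)
  let ?p = "[:-1, 1:] * subst_y_1 (T (Suc m))"
  have b2: "subst_y_1 (b2 (Suc (Suc m))) = [:int (Suc (Suc m)):]"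
    by (rule poly_eqI)
      (simp add: coeff_subst_y_1 b2_const coeff_pCons poly_sum poly_monom split: nat.split
        del: sum.lessThan_Suc)
  have x: "subst_y_1 (varx - vary) = [:-1, 1:]"
    by (rule poly_eqI) (simp add: coeff_subst_y_1 varx_def vary_def coeff_pCons split: nat.split)
  have y: "subst_y_1 (vary - 1) = 0"
    by (rule poly_eqI) (simp add: coeff_subst_y_1 vary_def one_pCons coeff_pCons split: nat.split)
  have T1: "coeff (subst_y_1 (T (Suc m))) m = 1"
    by (simp add: coeff_subst_y_1 lead_coeff_T)
  have T2: "degree (subst_y_1 (T (Suc m))) = m"
    using T1 by (intro antisym[OF degree_le le_degree]) (auto simp: coeff_subst_y_1 coeff_T)
  then have "subst_y_1 (T (Suc m)) \<noteq> 0"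
    using T1 by auto
  then have p: "degree ?p = Suc m"
    using T2 by (subst degree_mult_eq) auto
  have "subst_y_1 f = [:int (Suc (Suc m)):] * subst_y_1 A + subst_y_1 B * ?p"
    by (simp only: f subst_y_1_add subst_y_1_mult b2 x y mult_zero_right mult_zero_left add_0_right mult_ac)
  moreover have "lead_coeff ?p = 1"
    by (simp only: lead_coeff_mult T1 T2) simp
  moreover have "degree (subst_y_1 f) < degree ?p"
  proof -
    have "degree (subst_y_1 f) \<le> degree f"
      by (rule degree_le) (simp add: coeff_subst_y_1 coeff_eq_0)
    with assms(2) show ?thesis
      by (simp only: p)
  qed
  ultimately have "int (Suc (Suc m)) dvd coeff (subst_y_1 f) i"
    by (rule dvd_coeff_of_monic_combination)
  then show ?thesis
    by (simp add: coeff_subst_y_1)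
qed

section \<open>The strong Groebner basis\<close>

theorem theorem8:
  fixes n :: nat
  assumes "n \<ge> 2"
  shows "strong_groebner_basis lex_order (GBI n) (ideal_I n)"
proof -
  obtain m where n: "n = Suc (Suc m)"
    using assms by (metis Suc_le_D numeral_2_eq_2 Suc_le_mono)
  have "\<exists>g\<in>GBI n. term_dvd (lead_term lex_order g) (lead_term lex_order f)"
    if f: "f \<in> ideal_I n" "f \<noteq> 0" for f
  proof -
    define a where "a = degree f"
    define b where "b = degree (coeff f a)"
    define c where "c = coeff (coeff f a) b"
    have "c \<noteq> 0"
      using f by (simp add: a_def b_def c_def)
    then have lt: "lead_term lex_order f = mk_term c (a, b)"
      by (intro lead_term_eq) (simp_all add: a_def b_def c_def)
    note dvdI = term_dvd_mk_term[OF _ \<open>c \<noteq> 0\<close>]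
    consider "a \<ge> Suc m" | "a < m" | "a = m" "b > 0" | "a = m" "b = 0"
      by linarith
    then show ?thesis
    proof cases
      case 1
      then have "term_dvd (lead_term lex_order (g1 n)) (mk_term c (a, b))"
        unfolding n lead_term_g1 by (intro dvdI) simp_all
      then show ?thesis
        by (auto simp: lt GBI_def)
    next
      case 2
      have "(\<Sum>k<n. monom 1 k) dvd coeff f a"
        using b2_dvd_coeff[of f m a] f 2 unfolding n a_def by blast
      then have "Suc m \<le> b"
        using dvd_imp_degree_le[of "\<Sum>k<n. monom 1 k" "coeff f a"] f
        unfolding n degree_sum_monom b_def a_def by simp
      then have "term_dvd (lead_term lex_order (g2 n)) (mk_term c (a, b))"
        unfolding n lead_term_g2 by (intro dvdI) simp_all
      then show ?thesis
        by (auto simp: lt GBI_def)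
    next
      case 3
      show ?thesis
      proof (cases m)
        case 0
        \<comment> \<open>For \<open>n = 2\<close> the polynomial \<open>g4\<close> is the constant \<open>-2\<close>, but \<open>g2\<close> has leading term \<open>y\<close>.\<close>
        then have "term_dvd (lead_term lex_order (g2 n)) (mk_term c (a, b))"
          using 3 unfolding n lead_term_g2 by (intro dvdI) simp_all
        then show ?thesis
          by (auto simp: lt GBI_def)
      next
        case (Suc k)
        then have "term_dvd (lead_term lex_order (g4 n)) (mk_term c (a, b))"
          using 3 unfolding n Suc lead_term_g4 by (intro dvdI) simp_all
        then show ?thesis
          by (auto simp: lt GBI_def)
      qed
    next
      case 4
      then have "coeff f a = [:c:]"
        using degree_0_id[of "coeff f a"] unfolding c_def b_def by simp
      moreover have "int n dvd poly (coeff f a) 1"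
        using n_dvd_subst_y_1[of f m a] f 4 unfolding n a_def by simp
      ultimately have "int n dvd c"
        by simp
      then have "term_dvd (lead_term lex_order (g3 n)) (mk_term c (a, b))"
        using 4 unfolding n lead_term_g3 by (intro dvdI) simp_all
      then show ?thesis
        by (auto simp: lt GBI_def)
    qed
  qed
  then show ?thesis
    using GBI_subset_ideal[of "Suc m"] unfolding strong_groebner_basis_def n
    by (auto simp: GBI_def)
qed

end
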